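(* For the two-user SGUM based power control game there exists a unique socially-aware Nash equilibrium $(p_1^{SNE},p_2^{SNE})$, given by $$p_1^{SNE}=\sqrt{\alpha_1^2+\beta_1}-\alpha_1,\qquad p_2^{SNE}=\sqrt{\alpha_2^2+\beta_2}-\alpha_2,$$ where $$\alpha_1=\frac{w_{12}g_{12}+c_1n_2-g_{12}}{2c_1g_{12}},\quad\beta_1=\frac{n_2}{c_1g_{12}},\quad\alpha_2=\frac{w_{21}g_{21}+c_2n_1-g_{21}}{2c_2g_{21}},\quad\beta_2=\frac{n_1}{c_2g_{21}}.$$
   Context: Two users $i\in\{1,2\}$; user $i$ is a link with transmitter $T_i$ and receiver $R_i$, and chooses a transmit power $p_i\in(0,\infty)$. $h_i>0$ is the channel gain of link $i$, $g_{ij}>0$ ($i\ne j$) is the gain of the interference link from $T_i$ to $R_j$, $n_i>0$ is the noise at $R_i$, $c_i>0$ is the cost per unit power, and $w_{ij}\in[0,1]$ is the strength of user $i$'s social tie towards user $j$. For $j\neq i$: the SINR of link $i$ is $\gamma_i=\dfrac{h_ip_i}{n_i+g_{ji}p_j}$; individual utility $U_i=\log(\gamma_i)-c_ip_i$; social group utility $S_i=U_i+w_{ij}U_j$. In the SGUM based power control game, user $i$ chooses $p_i$ to maximize $S_i$. A socially-aware Nash equilibrium (SNE) is a profile $(p_1^*,p_2^* )$ such that each $p_i^*$ maximizes $S_i$ over $(0,\infty)$ given the other user's power. *)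

theory Defs
  imports Complex_Main
begin

datatype user = User1 | User2

fun other :: "user \<Rightarrow> user" where
  "other User1 = User2"
| "other User2 = User1"

(* g i j is the gain from transmitter i to receiver j, so the interference
   at receiver i is weighted by g (other i) i; diagonal values of g are never used. *)
definition sinr ::
  "(user \<Rightarrow> real) \<Rightarrow> (user \<Rightarrow> user \<Rightarrow> real) \<Rightarrow> (user \<Rightarrow> real) \<Rightarrow> (user \<Rightarrow> real) \<Rightarrow> user \<Rightarrow> real"
  where "sinr h g n p i = h i * p i / (n i + g (other i) i * p (other i))"

definition individual_utility ::
  "(user \<Rightarrow> real) \<Rightarrow> (user \<Rightarrow> user \<Rightarrow> real) \<Rightarrow> (user \<Rightarrow> real) \<Rightarrow> (user \<Rightarrow> real) \<Rightarrow>
   (user \<Rightarrow> real) \<Rightarrow> user \<Rightarrow> real"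
  where "individual_utility h g n c p i = ln (sinr h g n p i) - c i * p i"

(* w i j is the tie of user i towards user j; diagonal values of w are never used. *)
definition social_group_utility ::
  "(user \<Rightarrow> real) \<Rightarrow> (user \<Rightarrow> user \<Rightarrow> real) \<Rightarrow> (user \<Rightarrow> real) \<Rightarrow> (user \<Rightarrow> real) \<Rightarrow>
   (user \<Rightarrow> user \<Rightarrow> real) \<Rightarrow> (user \<Rightarrow> real) \<Rightarrow> user \<Rightarrow> real"
  where "social_group_utility h g n c w p i =
    individual_utility h g n c p i + w i (other i) * individual_utility h g n c p (other i)"

definition socially_aware_NE ::
  "(user \<Rightarrow> real) \<Rightarrow> (user \<Rightarrow> user \<Rightarrow> real) \<Rightarrow> (user \<Rightarrow> real) \<Rightarrow> (user \<Rightarrow> real) \<Rightarrow>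
   (user \<Rightarrow> user \<Rightarrow> real) \<Rightarrow> (user \<Rightarrow> real) \<Rightarrow> bool"
  where "socially_aware_NE h g n c w p \<longleftrightarrow>
    (\<forall>i. is_arg_max (\<lambda>q. social_group_utility h g n c w (p(i := q)) i) (\<lambda>q. q \<in> {0<..}) (p i))"

end

theory Submission
  imports Defs
begin

text \<open>
  As a function of its own power \<open>q\<close>, user \<open>i\<close>'s social group utility is
  \<open>ln q - c q - w ln (N + g q)\<close> plus a constant depending on the opponent's power, where \<open>N\<close> and
  \<open>g\<close> are the noise at the opponent's receiver and the gain towards it. Hence the game decouples:
  each user has a dominant strategy, the positive critical point \<open>r\<close> of this function.
  The critical point is the strict global maximum because of the weighted AM-GM inequality: with
  \<open>t = q / r\<close> and \<open>s = g r / (N + g r)\<close> we have \<open>ln ((N + g q) / (N + g r)) \<ge> s ln t\<close>, and the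
  first-order condition \<open>1 - w s = c r\<close> bounds the gain from deviating by \<open>c r (ln t - (t - 1)) < 0\<close>.
\<close>

text \<open>Logarithmic form of weighted AM-GM. With \<open>m\<close> the weighted mean of 1 and
  \<open>t\<close>, the tangent bound \<open>ln x \<le> x - 1\<close> is used at
  \<open>t / m\<close> and \<open>1 / m\<close>; averaged with weights \<open>s\<close> and
  \<open>1 - s\<close>, its right-hand sides cancel.\<close>

lemma ln_convex_comb_ge:
  fixes s t :: real
  assumes "0 \<le> s" "s < 1" "0 < t"
  shows "s * ln t \<le> ln (1 - s + s * t)"
proof -
  define m where "m = 1 - s + s * t"
  have "0 < m"
    using assms unfolding m_def by (intro add_pos_nonneg) auto
  have "s * (ln t - ln m) \<le> s * (t / m - 1)"
    using ln_le_minus_one[of "t / m"] assms \<open>0 < m\<close> by (intro mult_left_mono) (simp_all add: ln_div)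
  moreover have "(1 - s) * (- ln m) \<le> (1 - s) * (1 / m - 1)"
    using ln_le_minus_one[of "1 / m"] assms \<open>0 < m\<close> by (intro mult_left_mono) (simp_all add: ln_div)
  moreover have "s * (t / m - 1) + (1 - s) * (1 / m - 1) = 0"
    using \<open>0 < m\<close> by (simp add: m_def field_simps)
  ultimately show ?thesis
    unfolding m_def[symmetric] by (simp add: algebra_simps)
qed

lemma critical_point_strict_max:
  fixes c g N w q r :: real
  assumes pos: "0 < c" "0 < g" "0 < N" "0 \<le> w" "0 < q" "0 < r" and "q \<noteq> r"
    and crit: "1 / r = c + w * g / (N + g * r)"
  shows "ln q - c * q - w * ln (N + g * q) < ln r - c * r - w * ln (N + g * r)"
proof -
  define s where "s = g * r / (N + g * r)"
  define t where "t = q / r"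
  have d: "0 < N + g * r" "0 < N + g * q"
    using pos by (simp_all add: add_pos_pos)
  have s: "0 \<le> s" "s < 1" and t: "0 < t" "t \<noteq> 1"
    using pos d \<open>q \<noteq> r\<close> by (simp_all add: s_def t_def)
  have "1 - s = N / (N + g * r)" "s * t = g * q / (N + g * r)"
    using pos d by (simp_all add: s_def t_def field_simps)
  then have "(N + g * q) / (N + g * r) = 1 - s + s * t"
    by (simp add: add_divide_distrib)
  then have "s * ln t \<le> ln (N + g * q) - ln (N + g * r)"
    using ln_convex_comb_ge[OF s t(1)] d by (metis ln_div less_irrefl)
  then have 1: "w * (s * ln t) \<le> w * (ln (N + g * q) - ln (N + g * r))"
    using pos(4) by (rule mult_left_mono)
  \<comment> \<open>Multiplying by \<open>r\<close> expresses stationarity in the scaled variable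
    \<open>t = q / r\<close>, at \<open>t = 1\<close>.\<close>
  have "r * (1 / r) = r * (c + w * g / (N + g * r))"
    by (simp only: crit)
  then have foc: "1 - w * s = c * r"
    using pos by (simp add: s_def algebra_simps)
  \<comment> \<open>Strictness of the maximum enters here: equality would force
    \<open>t = 1\<close>, that is \<open>q = r\<close>.\<close>
  have "ln t < t - 1"
    using ln_le_minus_one[OF t(1)] ln_eq_minus_one[OF t(1)] t(2) by linarith
  then have "c * r * ln t < c * r * (t - 1)"
    using pos by simp
  also have "\<dots> = c * q - c * r"
    using pos by (simp add: t_def field_simps)
  finally have "(1 - w * s) * ln t < c * q - c * r"
    by (simp only: foc)
  then have "ln t - w * (s * ln t) < c * q - c * r"
    by (simp add: algebra_simps)
  moreover have "ln t = ln q - ln r"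
    using pos by (simp add: t_def ln_div)
  ultimately show ?thesis
    using 1 by (simp add: right_diff_distrib)
qed

text \<open>Completing the square gives the equation; \<open>b > 0\<close> makes the square root
  exceed the absolute value of \<open>a\<close>.\<close>

lemma positive_quadratic_root:
  fixes a b :: real
  assumes "0 < b"
  defines "r \<equiv> sqrt (a\<^sup>2 + b) - a"
  shows "0 < r" "r\<^sup>2 + 2 * a * r = b"
proof -
  have "sqrt (a\<^sup>2) < sqrt (a\<^sup>2 + b)"
    using assms by (intro real_sqrt_less_mono) simp
  then show "0 < r"
    by (simp add: r_def)
  have "(r + a)\<^sup>2 = a\<^sup>2 + b"
    using assms by (simp add: r_def)
  then show "r\<^sup>2 + 2 * a * r = b"
    by (simp add: power2_eq_square algebra_simps)
qed

text \<open>Clearing denominators in the conclusion gives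
  \<open>c * g * r^2 + (w * g + c * N - g) * r = N\<close>; dividing by \<open>c * g\<close> yields
  the hypothesis, whence the shape of the \<alpha> and \<beta> coefficients.\<close>

lemma quadratic_root_is_critical_point:
  fixes c g N w r :: real
  assumes pos: "0 < c" "0 < g" "0 < N" "0 < r"
    and quad: "r\<^sup>2 + 2 * ((w * g + c * N - g) / (2 * c * g)) * r = N / (c * g)"
  shows "1 / r = c + w * g / (N + g * r)"
proof -
  have "2 * ((w * g + c * N - g) / (2 * c * g)) = (w * g + c * N - g) / (c * g)"
    using pos by (simp add: divide_simps)
  then have "c * g * (r\<^sup>2 + (w * g + c * N - g) / (c * g) * r) = c * g * (N / (c * g))"
    by (simp only: quad[symmetric])
  then have "c * g * r\<^sup>2 + (w * g + c * N - g) * r = N"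
    using pos by (simp add: distrib_left)
  moreover have "0 < N + g * r"
    using pos by (simp add: add_pos_pos)
  ultimately show ?thesis
    using pos by (simp add: field_simps power2_eq_square)
qed

lemma is_arg_max_iff_strict_max:
  fixes f :: "'a \<Rightarrow> 'b :: order"
  assumes "P r" "\<And>q. P q \<Longrightarrow> q \<noteq> r \<Longrightarrow> f q < f r"
  shows "is_arg_max f P x \<longleftrightarrow> x = r"
  using assms by (auto simp: is_arg_max_def dest: less_asym)

lemma other_neq [simp]: "other i \<noteq> i" "i \<noteq> other i"
  by (cases i; simp)+

lemma other_other [simp]: "other (other i) = i"
  by (cases i) simp_all

text \<open>The bracketed summand is free of \<open>q\<close>, so it cancels when two choices of own
  power are compared.\<close>

lemma social_group_utility_own_power:
  assumes "0 < h i" "0 < h (other i)" "0 < n i" "0 < n (other i)"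
    and "0 < g i (other i)" "0 < g (other i) i" "0 < p (other i)" "0 < q"
  shows "social_group_utility h g n c w (p(i := q)) i =
    ln q - c i * q - w i (other i) * ln (n (other i) + g i (other i) * q) +
    (ln (h i) - ln (n i + g (other i) i * p (other i)) +
     w i (other i) * (ln (h (other i) * p (other i)) - c (other i) * p (other i)))"
proof -
  have "0 < n i + g (other i) i * p (other i)" "0 < n (other i) + g i (other i) * q"
    using assms by (simp_all add: add_pos_pos)
  then show ?thesis
    using assms
    by (simp add: social_group_utility_def individual_utility_def sinr_def ln_div ln_mult
        algebra_simps)
qed

text \<open>A single formula for both users: \<open>a\<close> plays the role of \<alpha> and the
  quotient under the root that of \<beta>.\<close>

definition best_power ::
  "(user \<Rightarrow> user \<Rightarrow> real) \<Rightarrow> (user \<Rightarrow> real) \<Rightarrow> (user \<Rightarrow> real) \<Rightarrow> (user \<Rightarrow> user \<Rightarrow> real) \<Rightarrow> user \<Rightarrow> real"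
  where "best_power g n c w i =
    (let j = other i; a = (w i j * g i j + c i * n j - g i j) / (2 * c i * g i j)
     in sqrt (a\<^sup>2 + n j / (c i * g i j)) - a)"

lemma best_power:
  assumes "0 < g i (other i)" "0 < n (other i)" "0 < c i"
  shows "0 < best_power g n c w i"
    and "1 / best_power g n c w i =
      c i + w i (other i) * g i (other i) / (n (other i) + g i (other i) * best_power g n c w i)"
proof -
  have b: "0 < n (other i) / (c i * g i (other i))"
    using assms by simp
  show pos: "0 < best_power g n c w i"
    using positive_quadratic_root(1)[OF b] by (simp add: best_power_def Let_def)
  show "1 / best_power g n c w i =
      c i + w i (other i) * g i (other i) / (n (other i) + g i (other i) * best_power g n c w i)"
    using positive_quadratic_root(2)[OF b] assms pos
    by (intro quadratic_root_is_critical_point) (simp_all only: best_power_def Let_def)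
qed

text \<open>The maximizer does not involve \<open>p\<close>, so it is a dominant strategy and no
  fixed-point argument is required.\<close>

lemma is_arg_max_social_group_utility_iff:
  assumes h_pos: "\<And>i. h i > 0"
    and g_pos: "\<And>i j. i \<noteq> j \<Longrightarrow> g i j > 0"
    and n_pos: "\<And>i. n i > 0"
    and c_pos: "\<And>i. c i > 0"
    and w_nonneg: "\<And>i j. i \<noteq> j \<Longrightarrow> w i j \<ge> 0"
    and p_pos: "p (other i) > 0"
  shows "is_arg_max (\<lambda>q. social_group_utility h g n c w (p(i := q)) i) (\<lambda>q. q \<in> {0<..}) x
    \<longleftrightarrow> x = best_power g n c w i"
proof (rule is_arg_max_iff_strict_max)
  have pos: "0 < best_power g n c w i"
    by (simp add: best_power(1) g_pos n_pos c_pos)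
  then show "best_power g n c w i \<in> {0<..}"
    by simp
  fix q :: real
  assume q: "q \<in> {0<..}" "q \<noteq> best_power g n c w i"
  let ?j = "other i" and ?r = "best_power g n c w i"
  have "ln q - c i * q - w i ?j * ln (n ?j + g i ?j * q)
      < ln ?r - c i * ?r - w i ?j * ln (n ?j + g i ?j * ?r)"
    using q pos by (intro critical_point_strict_max best_power(2))
      (simp_all add: g_pos n_pos c_pos w_nonneg)
  then show "social_group_utility h g n c w (p(i := q)) i
      < social_group_utility h g n c w (p(i := ?r)) i"
    using q pos by (simp add: social_group_utility_own_power h_pos g_pos n_pos p_pos)
qed

lemma socially_aware_NE_iff:
  assumes "\<And>i. h i > 0" "\<And>i j. i \<noteq> j \<Longrightarrow> g i j > 0" "\<And>i. n i > 0" "\<And>i. c i > 0"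
    and "\<And>i j. i \<noteq> j \<Longrightarrow> w i j \<ge> 0"
  shows "socially_aware_NE h g n c w p \<longleftrightarrow> p = best_power g n c w"
proof
  assume NE: "socially_aware_NE h g n c w p"
  \<comment> \<open>Feasibility of each user's own choice supplies the positive opponent power that
    the best-response characterization assumes.\<close>
  then have "p i > 0" for i
    by (simp add: socially_aware_NE_def is_arg_max_def)
  then have "p i = best_power g n c w i" for i
    using NE is_arg_max_social_group_utility_iff[OF assms] by (simp add: socially_aware_NE_def)
  then show "p = best_power g n c w"
    by blast
next
  assume p: "p = best_power g n c w"
  have "p i > 0" for i
    unfolding p by (rule best_power(1)) (simp_all add: assms)
  then show "socially_aware_NE h g n c w p"
    using is_arg_max_social_group_utility_iff[OF assms] by (simp add: socially_aware_NE_def p)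
qed

theorem theorem6:
  fixes h n c :: "user \<Rightarrow> real" and g w :: "user \<Rightarrow> user \<Rightarrow> real"
    and \<alpha>\<^sub>1 \<beta>\<^sub>1 \<alpha>\<^sub>2 \<beta>\<^sub>2 :: real
  assumes h_pos: "\<And>i. h i > 0"
    and g_pos: "\<And>i j. i \<noteq> j \<Longrightarrow> g i j > 0"
    and n_pos: "\<And>i. n i > 0"
    and c_pos: "\<And>i. c i > 0"
    and w_range: "\<And>i j. i \<noteq> j \<Longrightarrow> w i j \<in> {0..1}"
    and \<alpha>\<^sub>1: "\<alpha>\<^sub>1 = (w User1 User2 * g User1 User2 + c User1 * n User2 - g User1 User2)
                   / (2 * c User1 * g User1 User2)"
    and \<beta>\<^sub>1: "\<beta>\<^sub>1 = n User2 / (c User1 * g User1 User2)"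
    and \<alpha>\<^sub>2: "\<alpha>\<^sub>2 = (w User2 User1 * g User2 User1 + c User2 * n User1 - g User2 User1)
                   / (2 * c User2 * g User2 User1)"
    and \<beta>\<^sub>2: "\<beta>\<^sub>2 = n User1 / (c User2 * g User2 User1)"
  shows "(\<exists>!p. socially_aware_NE h g n c w p) \<and>
    (\<forall>p. socially_aware_NE h g n c w p \<longrightarrow>
      p User1 = sqrt (\<alpha>\<^sub>1\<^sup>2 + \<beta>\<^sub>1) - \<alpha>\<^sub>1 \<and> p User2 = sqrt (\<alpha>\<^sub>2\<^sup>2 + \<beta>\<^sub>2) - \<alpha>\<^sub>2)"
proof -
  have NE_iff: "socially_aware_NE h g n c w p \<longleftrightarrow> p = best_power g n c w" for p
    using h_pos g_pos n_pos c_pos w_range by (intro socially_aware_NE_iff) auto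
  show ?thesis
    unfolding NE_iff by (simp add: best_power_def Let_def \<alpha>\<^sub>1 \<beta>\<^sub>1 \<alpha>\<^sub>2 \<beta>\<^sub>2)
qed

end
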